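(* Let $q\ge 5$ and $d\ge 0$ be integers, and let $T$ be the complete $q$-ary tree of depth $d$. Then $\Phi_V(T)\ge d$.
   Context: The complete $q$-ary tree of depth $d$ is the rooted tree in which every vertex at distance less than $d$ from the root has exactly $q$ children, and the vertices at distance $d$ from the root are leaves. For a graph $G$ and $S\subseteq V(G)$, $\delta(S)=\{v\in V(G)\setminus S : N(v)\cap S\neq\emptyset\}$; $\Phi_V(G,s)=\min_{|S|=s}|\delta(S)|$ and $\Phi_V(G)=\max_{0\le s\le |V(G)|}\Phi_V(G,s)$. *)

theory Defs
  imports "Graph_Theory.Graph_Theory"
begin

text \<open>
  A finite simple graph is a \<^locale>\<open>pair_graph\<close>: a finite digraph whose arc relation is
  symmetric and irreflexive.
\<close>

definition graph_dist :: "'a pair_pre_digraph \<Rightarrow> 'a \<Rightarrow> 'a \<Rightarrow> nat" where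
  "graph_dist G u v = (LEAST n. \<exists>p. pre_digraph.awalk (with_proj G) u p v \<and> length p = n)"

text \<open>
  The library predicate \<^const>\<open>tree\<close> is meant for digraphs: in a symmetric digraph it counts
  every edge, traversed back and forth, as a cycle of length 2.  An undirected cycle is a
  (directed) cycle of length at least 3.
\<close>

definition undirected_tree :: "'a pair_pre_digraph \<Rightarrow> bool" where
  "undirected_tree G \<longleftrightarrow>
     pair_graph G \<and> Digraph_Component.connected (with_proj G) \<and>
     \<not> (\<exists>p. pre_digraph.cycle (with_proj G) p \<and> 3 \<le> length p)"

definition nbrs :: "'a pair_pre_digraph \<Rightarrow> 'a \<Rightarrow> 'a set" where
  "nbrs G v = {u. v \<rightarrow>\<^bsub>with_proj G\<^esub> u}"

definition children :: "'a pair_pre_digraph \<Rightarrow> 'a \<Rightarrow> 'a \<Rightarrow> 'a set" where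
  "children G r v = {w \<in> nbrs G v. graph_dist G r w = Suc (graph_dist G r v)}"

text \<open>
  A leaf of a rooted tree is a vertex without children; in particular, for \<open>d = 0\<close> the root is
  a leaf.
\<close>

definition complete_qary_tree :: "'a pair_pre_digraph \<Rightarrow> 'a \<Rightarrow> nat \<Rightarrow> nat \<Rightarrow> bool" where
  "complete_qary_tree T r q d \<longleftrightarrow>
     undirected_tree T \<and> r \<in> pverts T \<and>
     (\<forall>v\<in>pverts T. graph_dist T r v < d \<longrightarrow> card (children T r v) = q) \<and>
     (\<forall>v\<in>pverts T. graph_dist T r v = d \<longrightarrow> children T r v = {})"

definition vertex_boundary :: "'a pair_pre_digraph \<Rightarrow> 'a set \<Rightarrow> 'a set" where
  "vertex_boundary G S = {v \<in> pverts G - S. nbrs G v \<inter> S \<noteq> {}}"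

definition vertex_isoperimetric_value :: "'a pair_pre_digraph \<Rightarrow> nat \<Rightarrow> nat" where
  "vertex_isoperimetric_value G s =
     Min {card (vertex_boundary G S) |S. S \<subseteq> pverts G \<and> card S = s}"

definition vertex_isoperimetric_peak :: "'a pair_pre_digraph \<Rightarrow> nat" where
  "vertex_isoperimetric_peak G =
     Max {vertex_isoperimetric_value G s |s. s \<le> card (pverts G)}"


subsection \<open>The words of length at most \<open>d\<close> over \<open>q\<close> letters form a complete \<open>q\<close>-ary tree\<close>

definition word_tree :: "nat \<Rightarrow> nat \<Rightarrow> nat list pair_pre_digraph" where
  "word_tree q d =
     \<lparr> pverts = {w. set w \<subseteq> {..<q} \<and> length w \<le> d},
       parcs = {(v, w). set v \<subseteq> {..<q} \<and> set w \<subseteq> {..<q} \<and> length v \<le> d \<and> length w \<le> d \<and>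
                  ((\<exists>x. w = x # v) \<or> (\<exists>x. v = x # w))} \<rparr>"

lemma pair_graph_word_tree: "pair_graph (word_tree q d)"
proof -
  have fin: "finite (pverts (word_tree q d))"
    by (auto simp: word_tree_def finite_lists_length_le)
  have "parcs (word_tree q d) \<subseteq> pverts (word_tree q d) \<times> pverts (word_tree q d)"
    by (auto simp: word_tree_def)
  with fin have "finite (parcs (word_tree q d))"
    by (meson finite_SigmaI finite_subset)
  with fin show ?thesis
    by unfold_locales
      (auto simp: word_tree_def symmetric_def with_proj_def arcs_ends_def arc_to_ends_def
        intro!: symI)
qed

lemma word_tree_awalk_length:
  assumes "pcas u p v" "set p \<subseteq> parcs (word_tree q d)"
  shows "length v \<le> length u + length p"
  using assms
proof (induction u p v rule: pcas.induct)
  case (2 u e es v)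
  then have "length v \<le> length (snd e) + length es" by simp
  moreover have "length (snd e) \<le> Suc (length (fst e))"
    using 2 by (auto simp: word_tree_def)
  ultimately show ?case using 2 by simp
qed simp

lemma word_tree_awalk_exists:
  assumes "v \<in> pverts (word_tree q d)"
  shows "\<exists>p. pre_digraph.awalk (with_proj (word_tree q d)) [] p v \<and> length p = length v"
  using assms
proof (induction v)
  case Nil
  then show ?case
    by (intro exI[of _ "[]"]) (auto simp: pre_digraph.awalk_def cas_with_proj_eq)
next
  case (Cons x v)
  interpret pair_graph "word_tree q d" by (rule pair_graph_word_tree)
  from Cons have "v \<in> pverts (word_tree q d)" by (auto simp: word_tree_def)
  with Cons obtain p where p: "awalk [] p v" "length p = length v" by auto
  moreover have "(v, x # v) \<in> parcs (word_tree q d)"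
    using Cons.prems by (auto simp: word_tree_def)
  then have "awalk v [(v, x # v)] (x # v)"
    using arc_implies_awalk by fastforce
  ultimately have "awalk [] (p @ [(v, x # v)]) (x # v)" by auto
  with p show ?case by (intro exI[of _ "p @ [(v, x # v)]"]) auto
qed

lemma graph_dist_word_tree:
  assumes "v \<in> pverts (word_tree q d)"
  shows "graph_dist (word_tree q d) [] v = length v"
  unfolding graph_dist_def
proof (rule Least_equality)
  show "\<exists>p. pre_digraph.awalk (with_proj (word_tree q d)) [] p v \<and> length p = length v"
    using word_tree_awalk_exists[OF assms] .
next
  fix n assume "\<exists>p. pre_digraph.awalk (with_proj (word_tree q d)) [] p v \<and> length p = n"
  then show "length v \<le> n"
    using word_tree_awalk_length[of "[]" _ v q d]
    by (auto simp: pre_digraph.awalk_def cas_with_proj_eq)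
qed

lemma pcas_nth:
  assumes "pcas u p v" "Suc i < length p"
  shows "fst (p ! Suc i) = snd (p ! i)"
  using assms
proof (induction u p v arbitrary: i rule: pcas.induct)
  case (2 u e es v)
  then show ?case by (cases i; cases es) auto
qed simp

lemma pcas_ends:
  assumes "pcas u p v" "p \<noteq> []"
  shows "fst (p ! 0) = u" "snd (p ! (length p - 1)) = v"
  using assms by (induction u p v rule: pcas.induct) (auto split: if_splits simp: nth_Cons')

lemma word_tree_acyclic:
  assumes "pre_digraph.cycle (with_proj (word_tree q d)) p" "3 \<le> length p"
  shows False
proof -
  interpret pair_graph "word_tree q d" by (rule pair_graph_word_tree)
  from assms(1) obtain u where u: "awalk u p u" "distinct (tl (pawalk_verts u p))"
    by (auto simp: cycle_def)
  then have cas: "pcas u p u" and arcs: "set p \<subseteq> parcs (word_tree q d)"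
    by (auto simp: awalk_def)
  define n where "n = length p"
  have n: "3 \<le> n" "p \<noteq> []" using assms by (auto simp: n_def)
  have "tl (pawalk_verts u p) = map snd p"
    using awalk_verts_conv'[OF cas] n by simp
  with u have dist: "distinct (map snd p)" by simp
  have nxt: "fst (p ! (Suc i mod n)) = snd (p ! i)" if "i < n" for i
  proof (cases "Suc i < n")
    case True
    then show ?thesis using pcas_nth[OF cas, of i] by (simp add: n_def)
  next
    case False
    with that have "Suc i = n" by simp
    then have "i = n - 1" "Suc i mod n = 0" by auto
    then show ?thesis using pcas_ends[OF cas] n by (simp add: n_def)
  qed
  define i where "i = (ARG_MAX (\<lambda>i. length (snd (p ! i))) i. i < n)"
  have i: "i < n \<and> (\<forall>j. j < n \<longrightarrow> length (snd (p ! j)) \<le> length (snd (p ! i)))"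
    unfolding i_def
    by (rule arg_max_nat_lemma[where k=0 and b="Suc (Max ((\<lambda>i. length (snd (p ! i))) ` {..<n}))"])
      (use n in \<open>auto simp: less_Suc_eq_le\<close>)
  define j where "j = (i + (n - 1)) mod n"
  define k where "k = Suc i mod n"
  have jk: "j < n" "k < n" using n by (auto simp: j_def k_def)
  have "Suc j mod n = i"
    using i n by (auto simp: j_def mod_Suc_eq)
  with nxt[OF jk(1)] have fi: "fst (p ! i) = snd (p ! j)" by simp
  from nxt[of i] i have fk: "fst (p ! k) = snd (p ! i)" by (simp add: k_def)
  have parent: "a = tl b" if "(a, b) \<in> parcs (word_tree q d) \<or> (b, a) \<in> parcs (word_tree q d)"
    "length a \<le> length b" for a b
    using that by (auto simp: word_tree_def)
  have "p ! i \<in> parcs (word_tree q d)" "p ! k \<in> parcs (word_tree q d)"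
    using arcs i jk by (auto simp: n_def)
  with fi fk have "(snd (p ! j), snd (p ! i)) \<in> parcs (word_tree q d)"
    "(snd (p ! i), snd (p ! k)) \<in> parcs (word_tree q d)"
    by (metis prod.collapse)+
  with parent i jk have "snd (p ! j) = snd (p ! k)" by metis
  with dist jk have "j = k" by (simp add: distinct_conv_nth n_def) metis
  moreover have "j \<noteq> k"
  proof (cases "i = 0")
    case True
    then show ?thesis using n by (simp add: j_def k_def)
  next
    case False
    then have "j = i - 1" using i n by (auto simp: j_def mod_if)
    with False show ?thesis using i n by (cases "Suc i = n") (auto simp: k_def)
  qed
  ultimately show False by simp
qed

lemma connected_word_tree: "Digraph_Component.connected (with_proj (word_tree q d))"
proof -
  interpret pair_graph "word_tree q d" by (rule pair_graph_word_tree)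
  let ?G = "with_proj (word_tree q d)"
  have sym: "v \<rightarrow>\<^sup>*\<^bsub>?G\<^esub> u" if "u \<rightarrow>\<^sup>*\<^bsub>?G\<^esub> v" for u v
    using that symmetric_reachable[OF sym_arcs] by blast
  have "[] \<rightarrow>\<^sup>*\<^bsub>?G\<^esub> v" if "v \<in> pverts (word_tree q d)" for v
    using word_tree_awalk_exists[OF that] reachable_awalk by blast
  with sym have "u \<rightarrow>\<^sup>*\<^bsub>?G\<^esub> v"
    if "u \<in> pverts (word_tree q d)" "v \<in> pverts (word_tree q d)" for u v
    using that by (meson reachable_trans)
  moreover have "pverts (word_tree q d) \<noteq> {}"
    by (auto simp: word_tree_def intro: exI[of _ "[]"])
  ultimately have "strongly_connected ?G"
    by (auto simp: strongly_connected_def)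
  then show ?thesis
    by (auto simp: Digraph_Component.connected_def strongly_connected_def
        reachable_mk_symmetric_eq[OF sym_arcs])
qed

lemma children_word_tree:
  assumes v: "v \<in> pverts (word_tree q d)"
  shows "children (word_tree q d) [] v = (if length v < d then (\<lambda>x. x # v) ` {..<q} else {})"
proof -
  have "w \<in> children (word_tree q d) [] v \<longleftrightarrow> length v < d \<and> (\<exists>x<q. w = x # v)" for w
  proof
    assume w: "w \<in> children (word_tree q d) [] v"
    then have arc: "(v, w) \<in> parcs (word_tree q d)"
      by (simp add: children_def nbrs_def)
    then have "w \<in> pverts (word_tree q d)"
      by (simp add: word_tree_def)
    with v w have "length w = Suc (length v)"
      by (simp add: children_def graph_dist_word_tree)
    with arc show "length v < d \<and> (\<exists>x<q. w = x # v)"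
      by (auto simp: word_tree_def)
  next
    assume w: "length v < d \<and> (\<exists>x<q. w = x # v)"
    with v have "w \<in> pverts (word_tree q d)" "(v, w) \<in> parcs (word_tree q d)"
      by (auto simp: word_tree_def)
    with v w show "w \<in> children (word_tree q d) [] v"
      by (auto simp: children_def nbrs_def graph_dist_word_tree)
  qed
  then show ?thesis by auto
qed

lemma complete_qary_tree_word_tree: "complete_qary_tree (word_tree q d) [] q d"
  unfolding complete_qary_tree_def
proof (intro conjI ballI impI)
  show "undirected_tree (word_tree q d)"
    unfolding undirected_tree_def
    using pair_graph_word_tree connected_word_tree word_tree_acyclic by blast
  show "[] \<in> pverts (word_tree q d)"
    by (simp add: word_tree_def)
next
  fix v assume "v \<in> pverts (word_tree q d)" "graph_dist (word_tree q d) [] v < d"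
  then show "card (children (word_tree q d) [] v) = q"
    by (simp add: children_word_tree graph_dist_word_tree card_image inj_on_def)
next
  fix v assume "v \<in> pverts (word_tree q d)" "graph_dist (word_tree q d) [] v = d"
  then show "children (word_tree q d) [] v = {}"
    by (simp add: children_word_tree graph_dist_word_tree)
qed

end

theory Submission
  imports Defs
begin

text \<open>
  Let \<open>t\<^sub>h\<close> be the size of a complete subtree with \<open>h\<close> levels, so \<open>t\<^sub>0 = 0\<close> and
  \<open>t\<^sub>h\<^sub>+\<^sub>1 = q t\<^sub>h + 1\<close>.  A set \<open>S\<close> is determined by where its indicator changes along a tree
  edge, and every such edge has an endpoint in the boundary.  A boundary vertex at height \<open>h\<close>
  with \<open>k\<close> children in \<open>S\<close> thus contributes \<open>k t\<^sub>h - p t\<^sub>h\<^sub>+\<^sub>1\<close> to \<open>card S\<close>, where \<open>p = 1\<close> if its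
  parent is in \<open>S\<close> and \<open>p = 0\<close> otherwise; the root adds \<open>t\<^sub>d\<^sub>+\<^sub>1\<close> if it is in \<open>S\<close>.  For
  \<open>s = 2 (t\<^sub>1 + \<dots> + t\<^sub>d)\<close>, whose digits are far from both \<open>0\<close> and \<open>q\<close>, every level must be paid
  for: passing from height \<open>j\<close> to height \<open>j - 1\<close>, the remaining sum is
  \<open>c t\<^sub>j\<^sub>+\<^sub>1 + 2 (t\<^sub>1 + \<dots> + t\<^sub>j) + e\<close> with a carry \<open>c\<close> and an error \<open>e\<close>, and a potential that is
  linear in \<open>\<bar>c\<bar>\<close> and \<open>\<bar>e\<bar>\<close> shows that at least \<open>d\<close> terms are needed.
\<close>

section \<open>Arithmetic with subtree sizes as digits\<close>

primrec subtree_size :: "int \<Rightarrow> nat \<Rightarrow> int" where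
  "subtree_size q 0 = 0"
| "subtree_size q (Suc h) = q * subtree_size q h + 1"

text \<open>
  The carries \<open>0\<close> and \<open>-1\<close> are those that one term per level can sustain, hence cost nothing.
\<close>

definition excess :: "int \<Rightarrow> int" where
  "excess c = max c (- 1 - c)"

text \<open>Put \<open>b = c + P\<close>. For \<open>0 \<le> b < m\<close>, the left side and
  \<open>excess c\<close> are both at most \<open>m - 1\<close>. If \<open>b = m + x\<close> or
  \<open>b = - 1 - x\<close> with \<open>x \<ge> 0\<close>, then \<open>5 \<le> q\<close> gives
  \<open>excess c' \<ge> 5 * x + 2\<close>, which pays for the growth of both. The two sides yield
  the same bound because the digit \<open>2\<close> is the middle of \<open>0..4\<close>.\<close>

lemma excess_step:
  fixes q m P K c :: int
  assumes q: "5 \<le> q" and P: "0 \<le> P" "P \<le> m" and K: "0 \<le> K" "K \<le> q * m"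
  shows "\<bar>2 * (c + P) + 1 - m\<bar> \<le> 3 * (m - 1) + 2 * (excess (q * (c + P) + 2 - K) - excess c)"
proof -
  define b where "b = c + P"
  define c' where "c' = q * b + 2 - K"
  have ex: "c' \<le> excess c'" "- 1 - c' \<le> excess c'" "0 \<le> excess c'"
    "excess c = c \<or> excess c = - 1 - c"
    by (auto simp: excess_def)
  have "\<bar>2 * b + 1 - m\<bar> \<le> 3 * (m - 1) + 2 * (excess c' - excess c)"
  proof (cases "m \<le> b \<or> b < 0")
    case True
    then show ?thesis
    proof
      assume b: "m \<le> b"
      then have "5 * (b - m) \<le> q * (b - m)" using q by (intro mult_right_mono) auto
      then have "5 * (b - m) \<le> q * b - q * m" by (simp only: right_diff_distrib)
      then have "5 * (b - m) + 2 \<le> c'" using K c'_def by simp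
      then show ?thesis using b P ex b_def by (elim disjE) (simp_all add: abs_le_iff)
    next
      assume b: "b < 0"
      then have "0 \<le> (q - 5) * (- b)" using q by (intro mult_nonneg_nonneg) auto
      then have "q * b \<le> 5 * b" by (simp add: algebra_simps)
      then have "c' \<le> 5 * b + 2" using K c'_def by linarith
      then show ?thesis using b P ex b_def by (elim disjE) (simp_all add: abs_le_iff)
    qed
  next
    case False
    then have "0 \<le> b" "b + 1 \<le> m" by auto
    then show ?thesis using P ex(3,4) b_def by (elim disjE) (simp_all add: abs_le_iff)
  qed
  then show ?thesis by (simp add: b_def c'_def)
qed

text \<open>
  The summand \<open>(\<Sum>h\<le>j. m h) - int j - 1\<close> recentres the error so that the estimate becomes
  symmetric under exchanging \<open>S\<close> with the complement of \<open>S\<close> and its boundary.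
\<close>

lemma terms_lower_bound:
  fixes q c e :: int and m P K :: "nat \<Rightarrow> int"
  assumes q: "5 \<le> q"
    and P: "\<And>h. 0 \<le> P h" "\<And>h. P h \<le> m h"
    and K: "\<And>h. 0 \<le> K h" "\<And>h. K h \<le> q * m h"
    and "(\<Sum>h\<le>j. K h * subtree_size q h - P h * subtree_size q (Suc h)) =
      c * subtree_size q (Suc j) + 2 * (\<Sum>h\<le>j. subtree_size q h) + e"
  shows "3 * int j + 2 * excess c - \<bar>2 * e + (\<Sum>h\<le>j. m h) - int j - 1\<bar> \<le> 3 * (\<Sum>h\<le>j. m h)"
  using assms(6)
proof (induction j arbitrary: c e)
  case 0
  then show ?case using P[of 0] by (simp add: excess_def max_def abs_if)
next
  case (Suc j)
  let ?t = "subtree_size q"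
  \<comment> \<open>Moving the top term to the right and expanding
    \<open>t (j + 2) = q * t (j + 1) + 1\<close> collects the coefficient of
    \<open>t (j + 1)\<close> in \<open>c'\<close> and the left-over units in
    \<open>e'\<close>.\<close>
  define c' where "c' = q * (c + P (Suc j)) + 2 - K (Suc j)"
  define e' where "e' = e + c + P (Suc j)"
  have "(\<Sum>h\<le>j. K h * ?t h - P h * ?t (Suc h)) = c' * ?t (Suc j) + 2 * (\<Sum>h\<le>j. ?t h) + e'"
    using Suc.prems by (simp add: c'_def e'_def algebra_simps)
  from Suc.IH[OF this]
  have "3 * int j + 2 * excess c' - \<bar>2 * e' + (\<Sum>h\<le>j. m h) - int j - 1\<bar> \<le> 3 * (\<Sum>h\<le>j. m h)" .
  moreover have "\<bar>2 * (c + P (Suc j)) + 1 - m (Suc j)\<bar>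
      \<le> 3 * (m (Suc j) - 1) + 2 * (excess c' - excess c)"
    unfolding c'_def by (rule excess_step[OF q P K])
  ultimately show ?case
    by (simp add: e'_def)
qed

text \<open>The differences \<open>t (h + 1) - t h = (q - 1) * t h + 1\<close> telescope. This will
  show that the chosen size does not exceed the number of vertices.\<close>

lemma sum_subtree_size:
  "(q - 1) * (\<Sum>h\<le>d. subtree_size q h) = subtree_size q (Suc d) - int d - 1"
  by (induction d) (simp_all add: algebra_simps)

section \<open>Counting in a tree given by parents and heights\<close>

lemma sum_by_height:
  fixes f :: "'a \<Rightarrow> nat" and g :: "nat \<Rightarrow> int"
  assumes "finite A" "\<And>u. u \<in> A \<Longrightarrow> f u \<le> n"
  shows "(\<Sum>u\<in>A. g (f u)) = (\<Sum>h\<le>n. int (card {u \<in> A. f u = h}) * g h)"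
proof -
  have "(\<Sum>u\<in>A. g (f u)) = (\<Sum>h\<le>n. \<Sum>u | u \<in> A \<and> f u = h. g (f u))"
    using assms by (intro sum.group[symmetric]) auto
  then show ?thesis by simp
qed

text \<open>Only parents and heights above the leaf level enter the counting argument, so walks and
  distances are abstracted away. Nothing is assumed about \<open>par r\<close>.\<close>

locale qary_hierarchy =
  fixes V :: "'a set" and r :: 'a and par :: "'a \<Rightarrow> 'a" and height :: "'a \<Rightarrow> nat" and q :: nat
  assumes finite_V: "finite V"
    and root: "r \<in> V"
    and par_in: "u \<in> V - {r} \<Longrightarrow> par u \<in> V"
    and height_par: "u \<in> V - {r} \<Longrightarrow> height (par u) = Suc (height u)"
    and height_le: "v \<in> V \<Longrightarrow> height v \<le> height r"
    and card_kids: "v \<in> V \<Longrightarrow> card {u \<in> V - {r}. par u = v} = (if height v = 0 then 0 else q)"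
begin

abbreviation weight :: "'a \<Rightarrow> int" where
  "weight v \<equiv> subtree_size (int q) (Suc (height v))"

lemma weight_kids:
  assumes v: "v \<in> V"
  shows "weight v = 1 + (\<Sum>u | u \<in> V - {r} \<and> par u = v. weight u)"
proof -
  have "(\<Sum>u | u \<in> V - {r} \<and> par u = v. weight u)
      = (\<Sum>u | u \<in> V - {r} \<and> par u = v. subtree_size (int q) (height v))"
    by (intro sum.cong refl) (use height_par in fastforce)
  also have "\<dots> = int q * subtree_size (int q) (height v)"
    using card_kids[OF v] by simp
  finally show ?thesis by simp
qed

text \<open>Summation by parts: each vertex counts \<open>1\<close>, which is its own weight minus
  the weights of its children; regrouping by child leaves one term per edge.\<close>

lemma card_weight:
  assumes S: "S \<subseteq> V"
  shows "int (card S) = of_bool (r \<in> S) * weight r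
    + (\<Sum>u\<in>V - {r}. (of_bool (u \<in> S) - of_bool (par u \<in> S)) * weight u)"
proof -
  have "int (card S) = (\<Sum>v\<in>V. of_bool (v \<in> S))"
    using S finite_V by (simp add: Int_absorb1)
  also have "\<dots> = (\<Sum>v\<in>V. of_bool (v \<in> S) * weight v)
      - (\<Sum>v\<in>V. \<Sum>u | u \<in> V - {r} \<and> par u = v. of_bool (par u \<in> S) * weight u)"
    unfolding sum_subtractf[symmetric]
  proof (rule sum.cong[OF refl])
    fix v assume v: "v \<in> V"
    have "(\<Sum>u | u \<in> V - {r} \<and> par u = v. of_bool (par u \<in> S) * weight u)
        = of_bool (v \<in> S) * (weight v - 1)"
      unfolding weight_kids[OF v] by (simp add: sum_distrib_left)
    then show "of_bool (v \<in> S) = of_bool (v \<in> S) * weight v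
        - (\<Sum>u | u \<in> V - {r} \<and> par u = v. of_bool (par u \<in> S) * weight u)"
      by (simp add: algebra_simps)
  qed
  also have "(\<Sum>v\<in>V. \<Sum>u | u \<in> V - {r} \<and> par u = v. of_bool (par u \<in> S) * weight u)
      = (\<Sum>u\<in>V - {r}. of_bool (par u \<in> S) * weight u)"
    using finite_V par_in by (intro sum.group) auto
  also have "(\<Sum>v\<in>V. of_bool (v \<in> S) * weight v)
      = of_bool (r \<in> S) * weight r + (\<Sum>u\<in>V - {r}. of_bool (u \<in> S) * weight u)"
    by (simp add: sum.remove[OF finite_V root])
  finally show ?thesis by (simp add: sum_subtractf left_diff_distrib)
qed

lemma card_V: "int (card V) = weight r"
proof -
  have "(\<Sum>u\<in>V - {r}. (of_bool (u \<in> V) - of_bool (par u \<in> V)) * weight u) = 0"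
    using par_in by (intro sum.neutral) auto
  then show ?thesis using card_weight[of V] root by simp
qed

lemma boundary_lower_bound:
  assumes q: "5 \<le> q" and S: "S \<subseteq> V" and B: "B \<subseteq> V - S"
    and up: "\<And>u. u \<in> V - {r} \<Longrightarrow> u \<in> S \<Longrightarrow> par u \<notin> S \<Longrightarrow> par u \<in> B"
    and down: "\<And>u. u \<in> V - {r} \<Longrightarrow> u \<notin> S \<Longrightarrow> par u \<in> S \<Longrightarrow> u \<in> B"
    and card_S: "int (card S) = 2 * (\<Sum>h\<le>height r. subtree_size (int q) h)"
  shows "height r \<le> card B"
proof -
  let ?t = "subtree_size (int q)" and ?d = "height r"
  have fin: "finite B" using B finite_V finite_subset by blast
  \<comment> \<open>Edges where membership in \<open>S\<close> changes are named by their lower end.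
    In \<open>KS\<close> the boundary vertex is the parent, so terms are sorted by the height of the
    parent; in \<open>PS\<close> it is the child itself.\<close>
  define KS where "KS = {u \<in> V - {r}. u \<in> S \<and> par u \<in> B}"
  define PS where "PS = {u \<in> V - {r}. u \<in> B \<and> par u \<in> S}"
  define m where "m h = int (card {v \<in> B. height v = h})" for h
  define K where "K h = int (card {u \<in> KS. height (par u) = h})" for h
  define P where "P h = int (card {u \<in> PS. height u = h})" for h
  have finKS: "finite KS" and finPS: "finite PS" using finite_V by (simp_all add: KS_def PS_def)
  have "(\<Sum>u\<in>V - {r}. (of_bool (u \<in> S) - of_bool (par u \<in> S)) * weight u)
      = (\<Sum>u\<in>V - {r}. of_bool (u \<in> KS) * weight u - of_bool (u \<in> PS) * weight u)"
    using up down B by (intro sum.cong refl) (auto simp: KS_def PS_def)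
  also have "\<dots> = (\<Sum>u\<in>KS. weight u) - (\<Sum>u\<in>PS. weight u)"
  proof -
    have "(V - {r}) \<inter> KS = KS" "(V - {r}) \<inter> PS = PS" by (auto simp: KS_def PS_def)
    then show ?thesis
      using finite_V by (simp only: sum_subtractf of_bool_def if_distrib[of "\<lambda>x. x * _"] mult_1 mult_zero_left)
        (simp add: sum.inter_restrict[symmetric])
  qed
  also have "(\<Sum>u\<in>KS. weight u) = (\<Sum>u\<in>KS. ?t (height (par u)))"
    by (intro sum.cong refl) (simp add: KS_def height_par)
  also have "\<dots> = (\<Sum>h\<le>?d. K h * ?t h)"
    unfolding K_def using finKS B height_le by (intro sum_by_height) (auto simp: KS_def)
  also have "(\<Sum>u\<in>PS. weight u) = (\<Sum>h\<le>?d. P h * ?t (Suc h))"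
    unfolding P_def using finPS height_le by (intro sum_by_height) (auto simp: PS_def)
  \<comment> \<open>The root term moves to the right as the initial carry \<open>0\<close> or
    \<open>-1\<close>; both have excess \<open>0\<close>.\<close>
  finally have eq: "(\<Sum>h\<le>?d. K h * ?t h - P h * ?t (Suc h))
      = - of_bool (r \<in> S) * ?t (Suc ?d) + 2 * (\<Sum>h\<le>?d. ?t h) + 0"
    using card_weight[OF S] card_S unfolding sum_subtractf by linarith
  have P_le: "P h \<le> m h" for h
    unfolding P_def m_def of_nat_le_iff using fin by (intro card_mono) (auto simp: PS_def)
  have K_le: "K h \<le> int q * m h" for h
  proof -
    let ?M = "{v \<in> B. height v = h}"
    have "card {u \<in> KS. height (par u) = h} \<le> card (\<Union>v\<in>?M. {u \<in> V - {r}. par u = v})"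
      using fin finite_V by (intro card_mono) (auto simp: KS_def)
    also have "\<dots> \<le> (\<Sum>v\<in>?M. card {u \<in> V - {r}. par u = v})"
      using fin by (intro card_UN_le) auto
    also have "\<dots> \<le> (\<Sum>v\<in>?M. q)"
    proof (rule sum_mono)
      fix v assume "v \<in> ?M"
      then have "v \<in> V" using B by auto
      then show "card {u \<in> V - {r}. par u = v} \<le> q" by (simp only: card_kids split: if_splits) simp
    qed
    finally have "card {u \<in> KS. height (par u) = h} \<le> q * card ?M" by (simp add: mult.commute)
    then show ?thesis unfolding K_def m_def by (metis of_nat_le_iff of_nat_mult)
  qed
  have card_B: "int (card B) = (\<Sum>h\<le>?d. m h)"
    unfolding m_def using sum_by_height[of B height ?d "\<lambda>_. 1"] fin B height_le by auto
  have "3 * int ?d + 2 * excess (- of_bool (r \<in> S)) - \<bar>2 * 0 + (\<Sum>h\<le>?d. m h) - int ?d - 1\<bar>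
      \<le> 3 * (\<Sum>h\<le>?d. m h)"
    using q P_le K_le eq by (intro terms_lower_bound) (auto simp: P_def K_def)
  \<comment> \<open>If \<open>n = card B\<close> were below the height \<open>d\<close> of the root,
    this would read \<open>3 * d - (d + 1 - n) \<le> 3 * n\<close>, that is
    \<open>2 * d - 1 \<le> 2 * n\<close>, impossible for integers \<open>n < d\<close>.\<close>
  then show ?thesis
    unfolding card_B[symmetric] by (cases "r \<in> S") (auto simp: excess_def)
qed

end

section \<open>Parents in a connected graph without undirected cycles\<close>

locale rooted_acyclic_graph = pair_graph G for G :: "'a pair_pre_digraph" +
  fixes r :: 'a
  assumes root_in: "r \<in> pverts G"
    and connected: "Digraph_Component.connected (with_proj G)"
    and acyclic: "cycle p \<Longrightarrow> length p < 3"
begin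

lemma shortest_walk:
  assumes "v \<in> pverts G"
  obtains p where "awalk r p v" "length p = graph_dist G r v"
proof -
  have "r \<rightarrow>\<^sup>*\<^bsub>with_proj G\<^esub> v"
    using connected root_in assms
    by (auto simp: Digraph_Component.connected_def strongly_connected_def
        reachable_mk_symmetric_eq[OF sym_arcs])
  then have "\<exists>n p. awalk r p v \<and> length p = n" by (auto simp: reachable_awalk)
  then have "\<exists>p. awalk r p v \<and> length p = graph_dist G r v"
    unfolding graph_dist_def by (rule LeastI_ex)
  with that show thesis by blast
qed

lemma graph_dist_le: "awalk r p v \<Longrightarrow> graph_dist G r v \<le> length p"
  unfolding graph_dist_def by (rule Least_le) blast

lemma graph_dist_root: "graph_dist G r r = 0"
  using graph_dist_le[of "[]" r] root_in by (simp add: awalk_Nil_iff)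

lemma graph_dist_arc:
  assumes "(u, v) \<in> parcs G"
  shows "graph_dist G r v \<le> Suc (graph_dist G r u)"
proof -
  obtain p where p: "awalk r p u" "length p = graph_dist G r u"
    using shortest_walk in_arcsD1[OF assms] by blast
  moreover have "awalk u [(u, v)] v" using arc_implies_awalk[of "(u, v)"] assms by simp
  ultimately have "awalk r (p @ [(u, v)]) v" by auto
  from graph_dist_le[OF this] p show ?thesis by simp
qed

lemma ex_parent:
  assumes v: "v \<in> pverts G" "v \<noteq> r"
  shows "\<exists>u. (u, v) \<in> parcs G \<and> graph_dist G r v = Suc (graph_dist G r u)"
proof -
  obtain p where p: "awalk r p v" "length p = graph_dist G r v" using shortest_walk v by blast
  with v have "p \<noteq> []" by (auto simp: awalk_Nil_iff)
  then obtain p' e where e: "p = p' @ [e]" by (metis rev_exhaust)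
  with p have "awalk r p' (fst e)" "e \<in> parcs G" "snd e = v"
    by (auto simp: awalk_simps)
  then have "(fst e, v) \<in> parcs G" "graph_dist G r (fst e) \<le> length p'"
    using graph_dist_le by auto
  moreover from this have "graph_dist G r v \<le> Suc (graph_dist G r (fst e))"
    using graph_dist_arc by blast
  ultimately show ?thesis using p e by (intro exI[of _ "fst e"]) auto
qed

lemma shortest_walk_verts:
  assumes p: "awalk r p v" "length p = graph_dist G r v" and x: "x \<in> set (awalk_verts r p)"
  shows "graph_dist G r x \<le> graph_dist G r v"
proof -
  obtain p1 p2 where "p = p1 @ p2" "awalk r p1 x" using awalk_decomp[OF p(1) x] by blast
  with p(2) graph_dist_le[of p1 x] show ?thesis by simp
qed

text \<open>Shortest walks from the root to \<open>u\<close> and to \<open>w\<close> stay too close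
  to the root to meet \<open>v\<close>. Joined and shortened, they give a path from \<open>u\<close>
  to \<open>w\<close> avoiding \<open>v\<close>; if \<open>u \<noteq> w\<close> it has an arc, and
  closing it through \<open>v\<close> gives a cycle of length at least \<open>3\<close>.\<close>

lemma parent_unique:
  assumes arcs: "(u, v) \<in> parcs G" "(w, v) \<in> parcs G"
    and dist: "graph_dist G r u < graph_dist G r v" "graph_dist G r w < graph_dist G r v"
  shows "u = w"
proof (rule ccontr)
  assume neq: "u \<noteq> w"
  obtain p where p: "awalk r p u" "length p = graph_dist G r u"
    using shortest_walk in_arcsD1[OF arcs(1)] by blast
  obtain p' where p': "awalk r p' w" "length p' = graph_dist G r w"
    using shortest_walk in_arcsD1[OF arcs(2)] by blast
  have avoid: "v \<notin> set (awalk_verts r p)" "v \<notin> set (awalk_verts r p')"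
    using shortest_walk_verts[OF p] shortest_walk_verts[OF p'] dist by fastforce+
  have rev: "awalk u (rev_path p) r" using p by simp
  define c where "c = awalk_to_apath (rev_path p @ p')"
  have walk: "awalk u (rev_path p @ p') w" using rev p' by auto
  then have c: "apath u c w" unfolding c_def by (rule apath_awalk_to_apath)
  have "v \<notin> set (awalk_verts u (rev_path p @ p'))"
    using avoid set_awalk_verts_append[OF rev p'(1)] awalk_verts_rev_path[OF p(1)] by simp
  moreover have "set (awalk_verts u c) \<subseteq> set (awalk_verts u (rev_path p @ p'))"
    using awalk_to_apath_subset[OF walk] set_awalk_verts[OF walk]
      set_awalk_verts[OF awalkI_apath[OF c]]
    by (auto simp: c_def)
  ultimately have v: "v \<notin> set (awalk_verts u c)" by blast
  have arc': "(v, u) \<in> parcs G" using arcs(1) by (rule arcs_symmetric)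
  have "awalk w [(w, v)] v" using arc_implies_awalk[of "(w, v)"] arcs by simp
  then have cv: "awalk u (c @ [(w, v)]) v" using awalkI_apath[OF c] by auto
  with arc' have "awalk v ((v, u) # c @ [(w, v)]) v"
    by (simp add: awalk_Cons_iff del: awalk_append_iff)
  moreover have "awalk_verts u (c @ [(w, v)]) = awalk_verts u c @ [v]"
    using awalk_verts_append[OF cv] by simp
  then have "distinct (tl (awalk_verts v ((v, u) # c @ [(w, v)])))"
    using c v by (simp add: apath_def)
  ultimately have "cycle ((v, u) # c @ [(w, v)])"
    unfolding cycle_def by blast
  moreover have "c \<noteq> []" using c neq by (auto simp: apath_def awalk_Nil_iff)
  then have "3 \<le> length ((v, u) # c @ [(w, v)])" by (cases c) auto
  ultimately show False using acyclic by (meson not_less)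
qed

definition parent :: "'a \<Rightarrow> 'a" where
  "parent v = (SOME u. (u, v) \<in> parcs G \<and> graph_dist G r v = Suc (graph_dist G r u))"

lemma parent:
  assumes "v \<in> pverts G - {r}"
  shows "(parent v, v) \<in> parcs G" "graph_dist G r v = Suc (graph_dist G r (parent v))"
  using someI_ex[OF ex_parent[of v]] assms by (auto simp: parent_def)

lemma children_eq: "children G r v = {u \<in> pverts G - {r}. parent u = v}"
proof (intro set_eqI iffI)
  fix w assume "w \<in> children G r v"
  then have w: "(v, w) \<in> parcs G" "graph_dist G r w = Suc (graph_dist G r v)"
    by (auto simp: children_def nbrs_def)
  then have "w \<in> pverts G - {r}" using in_arcsD2 graph_dist_root by auto
  moreover from this have "parent w = v"
    using parent[of w] w by (intro parent_unique[of _ w]) auto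
  ultimately show "w \<in> {u \<in> pverts G - {r}. parent u = v}" by simp
next
  fix w assume "w \<in> {u \<in> pverts G - {r}. parent u = v}"
  then show "w \<in> children G r v" using parent[of w] by (auto simp: children_def nbrs_def)
qed

text \<open>A vertex beyond distance \<open>d\<close> would have an ancestor at distance
  \<open>d + 1\<close>, whose parent would be a leaf with a child.\<close>

lemma graph_dist_bounded:
  assumes leaves: "\<And>v. v \<in> pverts G \<Longrightarrow> graph_dist G r v = d \<Longrightarrow> children G r v = {}"
    and "v \<in> pverts G"
  shows "graph_dist G r v \<le> d"
  using assms(2)
proof (induction "graph_dist G r v" arbitrary: v)
  case (Suc n)
  then have v: "v \<in> pverts G - {r}" using graph_dist_root by auto
  have u: "parent v \<in> pverts G" using parent(1)[OF v] in_arcsD1 by blast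
  have n: "n = graph_dist G r (parent v)" using parent(2)[OF v] Suc by simp
  with Suc u have "n \<le> d" by blast
  moreover have "v \<in> children G r (parent v)" using v by (simp add: children_eq)
  with leaves[OF u] n have "n \<noteq> d" by auto
  ultimately show ?case using Suc by simp
qed simp

end

section \<open>The isoperimetric peak of the tree\<close>

theorem theorem3p1:
  fixes T :: "'a pair_pre_digraph" and r :: 'a and q d :: nat
  assumes "q \<ge> 5"
    and "complete_qary_tree T r q d"
  shows "vertex_isoperimetric_peak T \<ge> d"
proof -
  let ?V = "pverts T"
  let ?dist = "graph_dist T r"
  have tree: "undirected_tree T" and r: "r \<in> ?V"
    and inner: "\<And>v. v \<in> ?V \<Longrightarrow> ?dist v < d \<Longrightarrow> card (children T r v) = q"
    and leaves: "\<And>v. v \<in> ?V \<Longrightarrow> ?dist v = d \<Longrightarrow> children T r v = {}"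
    using assms(2) by (auto simp: complete_qary_tree_def)
  interpret pair_graph T using tree by (simp add: undirected_tree_def)
  interpret rooted_acyclic_graph T r
    using tree r by unfold_locales (auto simp: undirected_tree_def not_less)
  have bounded: "?dist v \<le> d" if "v \<in> ?V" for v
    using leaves that by (rule graph_dist_bounded)
  interpret qary_hierarchy ?V r parent "\<lambda>v. d - ?dist v" q
  proof
    show "finite ?V" by simp
    show "r \<in> ?V" by (rule r)
  next
    fix u assume u: "u \<in> ?V - {r}"
    show "parent u \<in> ?V" using parent(1)[OF u] in_arcsD1 by blast
    show "d - ?dist (parent u) = Suc (d - ?dist u)"
      using parent(2)[OF u] bounded[of u] u by auto
  next
    fix v assume v: "v \<in> ?V"
    show "d - ?dist v \<le> d - ?dist r" by (simp add: graph_dist_root)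
    show "card {u \<in> ?V - {r}. parent u = v} = (if d - ?dist v = 0 then 0 else q)"
      using inner[OF v] leaves[OF v] bounded[OF v] unfolding children_eq
      by (cases "?dist v = d") auto
  qed
  define s where "s = nat (2 * (\<Sum>h\<le>d. subtree_size (int q) h))"
  have size_nonneg: "0 \<le> subtree_size (int q) h" for h by (induction h) auto
  then have sum_nonneg: "0 \<le> (\<Sum>h\<le>d. subtree_size (int q) h)" by (intro sum_nonneg) auto
  \<comment> \<open>The right side equals \<open>card ?V - d - 1\<close>, so sets of size
    \<open>s\<close> exist and the minimum below is taken over a nonempty set.\<close>
  have "2 * (\<Sum>h\<le>d. subtree_size (int q) h) \<le> (int q - 1) * (\<Sum>h\<le>d. subtree_size (int q) h)"
    using sum_nonneg assms(1) by (intro mult_right_mono) auto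
  then have s_le: "s \<le> card ?V"
    using card_V sum_nonneg unfolding sum_subtree_size s_def by (simp add: graph_dist_root)
  have bound: "d \<le> card (vertex_boundary T S)" if S: "S \<subseteq> ?V" "card S = s" for S
  proof -
    have "d - ?dist r \<le> card (vertex_boundary T S)"
    proof (rule boundary_lower_bound[OF assms(1) S(1)])
      show "vertex_boundary T S \<subseteq> ?V - S" by (auto simp: vertex_boundary_def)
      show "int (card S) = 2 * (\<Sum>h\<le>d - ?dist r. subtree_size (int q) h)"
        using S(2) sum_nonneg by (simp add: s_def graph_dist_root)
    next
      fix u assume u: "u \<in> ?V - {r}"
      note arc = parent(1)[OF u] arcs_symmetric[OF parent(1)[OF u]]
      show "parent u \<in> vertex_boundary T S" if "u \<in> S" "parent u \<notin> S"
        using that arc in_arcsD1 by (auto simp: vertex_boundary_def nbrs_def)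
      show "u \<in> vertex_boundary T S" if "u \<notin> S" "parent u \<in> S"
        using that arc u by (auto simp: vertex_boundary_def nbrs_def)
    qed
    then show ?thesis by (simp add: graph_dist_root)
  qed
  have "d \<le> vertex_isoperimetric_value T s"
    unfolding vertex_isoperimetric_value_def
  proof (rule Min.boundedI)
    show "finite {card (vertex_boundary T S) |S. S \<subseteq> ?V \<and> card S = s}"
      by simp
    show "{card (vertex_boundary T S) |S. S \<subseteq> ?V \<and> card S = s} \<noteq> {}"
      using obtain_subset_with_card_n[OF s_le] by blast
  qed (use bound in blast)
  also have "\<dots> \<le> vertex_isoperimetric_peak T"
    unfolding vertex_isoperimetric_peak_def using s_le by (intro Max_ge) auto
  finally show ?thesis .
qed

end
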